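(* Let an LTI descriptor system $E\dot z(t)=Az(t)+Bu(t)$ be given, with $E,A\in\mathbb R^{n\times n}$ and $B\in\mathbb R^{n\times m}$. Let $\mathcal S_E\subseteq\mathbb R^{n\times n}$, $\mathcal S_A\subseteq\mathbb R^{n\times n}$ and $\mathcal S_B\subseteq\mathbb R^{n\times m}$ be linear subspaces (or affine subsets), characterizing the perturbations allowed in $E$, $A$ and $B$ respectively, and let $$SR_c=\min_{\Delta_E\in\mathcal S_E,\ \Delta_A\in\mathcal S_A,\ \Delta_B\in\mathcal S_B}\left\{\left\|[\Delta_E\ \ \Delta_A\ \ \Delta_B]\right\|_F\;:\;(E+\Delta_E,\,A+\Delta_A,\,B+\Delta_B)\text{ is uncontrollable}\right\}$$ denote the structured real radius of controllability of the system. Then $SR_c$ can be computed by computing the nearest structured low rank approximation (SLRA) $\mathcal C(E+\Delta E,\,A+\Delta A,\,B+\Delta B)$ to $\mathcal C(E,A,B)$, by solving the following optimization problem: $$SR_c=\min_{\Delta_E\in\mathcal S_E,\ \Delta_A\in\mathcal S_A,\ \Delta_B\in\mathcal S_B}\left\{\left\|[\Delta_E\ \ \Delta_A\ \ \Delta_B]\right\|_F\;:\;\mathcal C(E+\Delta_E,\,A+\Delta_A,\,B+\Delta_B)\text{ is not of full row rank}\right\}.$$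
   Context: A triple $(E,A,B)$ with $E,A\in\mathbb R^{n\times n}$, $B\in\mathbb R^{n\times m}$ (equivalently the descriptor system $E\dot z=Az+Bu$) is C-controllable if and only if (1) $\operatorname{rank}[sE-A\ \ B]=n$ for all finite $s\in\mathbb C$, and (2) $\operatorname{rank}[E\ \ B]=n$. It is called uncontrollable (C-uncontrollable) if it is not C-controllable. $\mathcal C(E,A,B)\in\mathbb R^{n^2\times n(n+m-1)}$ is the block Toeplitz structured matrix $$\mathcal C(E,A,B)=\begin{bmatrix}-A&B& & & & & & \\ E&0&-A&B& & & & \\ & &E&0& & & & \\ & & & &\ddots& & & \\ & & & & &-A&B& \\ & & & & &E&0&B\end{bmatrix}.$$ It has $n$ block rows of height $n$. For each $j=1,\dots,n-1$ there is a block column of width $n+m$ whose block in block row $j$ is $[-A\ \ B]$, whose block in block row $j+1$ is $[E\ \ 0]$, and whose other blocks are zero; there is one final block column of width $m$ whose block in block row $n$ is $B$ and whose other blocks are zero. The nearest structured low rank approximation (SLRA) to $\mathcal C(E,A,B)$ here means the matrix $\mathcal C(E+\Delta E,\,A+\Delta A,\,B+\Delta B)$ for which the admissible perturbations $(\Delta E,\Delta A,\Delta B)\in\mathcal S_E\times\mathcal S_A\times\mathcal S_B$ have the smallest value of $\|[\Delta E\ \ \Delta A\ \ \Delta B]\|_F$ among all admissible perturbations making this matrix not of full row rank. $\|\cdot\|_F$ is the Frobenius norm. *)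

theory Defs
  imports Complex_Main "Jordan_Normal_Form.DL_Rank"
begin

text \<open>Block matrix with \<open>A\<close> to the left of \<open>B\<close>; both must have the same number of rows.\<close>

definition append_cols :: "'a :: zero mat \<Rightarrow> 'a mat \<Rightarrow> 'a mat" (infixr "@\<^sub>c" 65) where
  "A @\<^sub>c B = four_block_mat A B (0\<^sub>m 0 (dim_col A)) (0\<^sub>m 0 (dim_col B))"

definition frob_norm :: "real mat \<Rightarrow> real" where
  "frob_norm M = sqrt (\<Sum>i<dim_row M. \<Sum>j<dim_col M. (M $$ (i, j))\<^sup>2)"

definition full_row_rank :: "'a :: field mat \<Rightarrow> bool" where
  "full_row_rank M \<longleftrightarrow> vec_space.rank (dim_row M) M = dim_row M"

definition C_controllable :: "nat \<Rightarrow> real mat \<Rightarrow> real mat \<Rightarrow> real mat \<Rightarrow> bool" where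
  "C_controllable n E A B \<longleftrightarrow>
     (\<forall>s :: complex. vec_space.rank n
        ((s \<cdot>\<^sub>m map_mat complex_of_real E - map_mat complex_of_real A)
           @\<^sub>c map_mat complex_of_real B) = n) \<and>
     vec_space.rank n (E @\<^sub>c B) = n"

text \<open>
  Entry \<open>(i, j)\<close> lies in block row \<open>p\<close> and block column \<open>q\<close> (both counted from \<open>0\<close>), at
  position \<open>(r, c)\<close> inside that block. Block columns \<open>0, \<dots>, n - 2\<close> have width \<open>n + m\<close>;
  the last one, \<open>q = n - 1\<close>, has width \<open>m\<close>, so \<open>c < m\<close> there. For \<open>n = 1\<close> only this last
  block column is present and the matrix is \<open>B\<close>.\<close>

definition ctrb_mat ::
  "nat \<Rightarrow> nat \<Rightarrow> real mat \<Rightarrow> real mat \<Rightarrow> real mat \<Rightarrow> real mat" where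
  "ctrb_mat n m E A B = mat (n\<^sup>2) (n * (n + m - 1)) (\<lambda>(i, j).
     let p = i div n; r = i mod n; q = j div (n + m); c = j mod (n + m) in
     if q < n - 1 then
       (if p = q then (- A @\<^sub>c B) $$ (r, c)
        else if p = q + 1 then (E @\<^sub>c 0\<^sub>m n m) $$ (r, c)
        else 0)
     else (if p = n - 1 then B $$ (r, c) else 0))"

definition affine_mats :: "nat \<Rightarrow> nat \<Rightarrow> real mat set \<Rightarrow> bool" where
  "affine_mats nr nc S \<longleftrightarrow> S \<subseteq> carrier_mat nr nc \<and>
     (\<forall>X\<in>S. \<forall>Y\<in>S. \<forall>u v. u + v = 1 \<longrightarrow> u \<cdot>\<^sub>m X + v \<cdot>\<^sub>m Y \<in> S)"

definition perturbation_set :: "nat \<Rightarrow> nat \<Rightarrow> real mat set \<Rightarrow> bool" where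
  "perturbation_set nr nc S \<longleftrightarrow>
     subspace class_ring S (module_mat TYPE(real) nr nc) \<or> affine_mats nr nc S"

definition uncontrollable_norms ::
  "nat \<Rightarrow> real mat \<Rightarrow> real mat \<Rightarrow> real mat \<Rightarrow>
   real mat set \<Rightarrow> real mat set \<Rightarrow> real mat set \<Rightarrow> real set" where
  "uncontrollable_norms n E A B SE SA SB =
     {frob_norm (DE @\<^sub>c DA @\<^sub>c DB) | DE DA DB. DE \<in> SE \<and> DA \<in> SA \<and> DB \<in> SB \<and>
        \<not> C_controllable n (E + DE) (A + DA) (B + DB)}"

definition rank_deficient_norms ::
  "nat \<Rightarrow> nat \<Rightarrow> real mat \<Rightarrow> real mat \<Rightarrow> real mat \<Rightarrow>
   real mat set \<Rightarrow> real mat set \<Rightarrow> real mat set \<Rightarrow> real set" where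
  "rank_deficient_norms n m E A B SE SA SB =
     {frob_norm (DE @\<^sub>c DA @\<^sub>c DB) | DE DA DB. DE \<in> SE \<and> DA \<in> SA \<and> DB \<in> SB \<and>
        \<not> full_row_rank (ctrb_mat n m (E + DE) (A + DA) (B + DB))}"

definition is_minimum :: "real set \<Rightarrow> real \<Rightarrow> bool" where
  "is_minimum S r \<longleftrightarrow> r \<in> S \<and> (\<forall>x\<in>S. r \<le> x)"

text \<open>Unspecified if the set of norms has no minimum, in particular if it is empty.\<close>

definition structured_radius ::
  "nat \<Rightarrow> real mat \<Rightarrow> real mat \<Rightarrow> real mat \<Rightarrow>
   real mat set \<Rightarrow> real mat set \<Rightarrow> real mat set \<Rightarrow> real" where
  "structured_radius n E A B SE SA SB = (LEAST r. r \<in> uncontrollable_norms n E A B SE SA SB)"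

text \<open>
  The nearest structured low rank approximation to \<open>ctrb_mat n m E A B\<close> is represented by its
  perturbation: it is the matrix \<open>ctrb_mat n m (E + DE) (A + DA) (B + DB)\<close>.\<close>

definition nearest_SLRA ::
  "nat \<Rightarrow> nat \<Rightarrow> real mat \<Rightarrow> real mat \<Rightarrow> real mat \<Rightarrow>
   real mat set \<Rightarrow> real mat set \<Rightarrow> real mat set \<Rightarrow>
   real mat \<Rightarrow> real mat \<Rightarrow> real mat \<Rightarrow> bool" where
  "nearest_SLRA n m E A B SE SA SB DE DA DB \<longleftrightarrow>
     is_arg_min (\<lambda>(X, Y, Z). frob_norm (X @\<^sub>c Y @\<^sub>c Z))
       (\<lambda>(X, Y, Z). X \<in> SE \<and> Y \<in> SA \<and> Z \<in> SB \<and>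
          \<not> full_row_rank (ctrb_mat n m (E + X) (A + Y) (B + Z)))
       (DE, DA, DB)"

end

theory Submission
  imports Defs "HOL-Computational_Algebra.Fundamental_Theorem_Algebra"
begin

text \<open>
  A left null vector of the block Toeplitz matrix is a chain of row vectors
  \<open>w 0, \<dots>, w (n - 1)\<close> with \<open>w j A = w (j + 1) E\<close> and \<open>w j B = 0\<close>. If \<open>v (s E - A) = 0\<close> and
  \<open>v B = 0\<close>, then the real or the imaginary part of \<open>w j = s ^ j v\<close> is a nonzero chain, and if
  \<open>v E = 0\<close> and \<open>v B = 0\<close>, then \<open>0, \<dots>, 0, v\<close> is one. Conversely, let \<open>w k\<close> be the first term
  depending linearly on the earlier ones, \<open>w k = a 0 w 0 + \<dots> + a (k - 1) w (k - 1)\<close>; a root \<open>s\<close>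
  of \<open>x ^ k - a (k - 1) x ^ (k - 1) - \<dots> - a 0 = (x - s) q(x)\<close> yields the vector
  \<open>v = q 0 w 0 + \<dots> + q (k - 1) w (k - 1) \<noteq> 0\<close> with \<open>v (s E - A) = 0\<close> and \<open>v B = 0\<close>.
  The minimum is attained by compactness: normalized chains survive the passage to a limit of a
  minimizing sequence, and affine sets of matrices are closed.\<close>

section \<open>Separation in finite dimension, rank and left kernels\<close>

lemma separating_functional:
  fixes V :: "('i \<Rightarrow> 'a :: field) set" and x :: "'i \<Rightarrow> 'a"
  assumes "finite I" and "(\<lambda>_. 0) \<in> V"
    and "\<And>f g t. f \<in> V \<Longrightarrow> g \<in> V \<Longrightarrow> (\<lambda>i. f i + t * g i) \<in> V"
    and "\<And>v. v \<in> V \<Longrightarrow> \<exists>i\<in>I. v i \<noteq> x i"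
  shows "\<exists>w. (\<forall>v\<in>V. (\<Sum>i\<in>I. w i * v i) = 0) \<and> (\<Sum>i\<in>I. w i * x i) \<noteq> 0"
  using assms
proof (induction I arbitrary: V x rule: finite_induct)
  case empty
  then show ?case by auto
next
  case (insert a I)
  show ?case
  proof (cases "\<exists>u\<in>V. u a \<noteq> 0")
    case True
    then obtain u0 where u0: "u0 \<in> V" "u0 a \<noteq> 0" by auto
    define u where "u = (\<lambda>i. 0 + inverse (u0 a) * u0 i)"
    have u: "u \<in> V" "u a = 1"
      using insert.prems(2)[OF insert.prems(1) u0(1)] u0(2) by (auto simp: u_def)
    have "\<exists>w. (\<forall>v\<in>{v \<in> V. v a = 0}. (\<Sum>i\<in>I. w i * v i) = 0) \<and>
            (\<Sum>i\<in>I. w i * (x i - x a * u i)) \<noteq> 0"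
    proof (rule insert.IH)
      show "\<exists>i\<in>I. v i \<noteq> x i - x a * u i" if "v \<in> {v \<in> V. v a = 0}" for v
        using insert.prems(3)[OF insert.prems(2)[OF _ u(1), of v "x a"]] that u(2) by force
    qed (use insert.prems in auto)
    then obtain w where w: "\<And>v. v \<in> V \<Longrightarrow> v a = 0 \<Longrightarrow> (\<Sum>i\<in>I. w i * v i) = 0"
      and wx: "(\<Sum>i\<in>I. w i * (x i - x a * u i)) \<noteq> 0" by auto
    \<comment> \<open>The coefficient at \<open>a\<close> is the one that makes the new functional
      vanish at \<open>u\<close>; its value at any \<open>y\<close> is then that of \<open>w\<close>
      at \<open>y - y a * u\<close>.\<close>
    define w' where "w' = w(a := - (\<Sum>i\<in>I. w i * u i))"
    have eq: "(\<Sum>i\<in>insert a I. w' i * y i) = (\<Sum>i\<in>I. w i * (y i - y a * u i))" for y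
    proof -
      have "(\<Sum>i\<in>I. w' i * y i) = (\<Sum>i\<in>I. w i * y i)"
        using insert.hyps(2) by (intro sum.cong) (auto simp: w'_def)
      then show ?thesis
        using insert.hyps
        by (simp add: w'_def sum_subtractf sum_distrib_left sum_distrib_right algebra_simps)
    qed
    have "(\<Sum>i\<in>I. w i * (v i - v a * u i)) = 0" if "v \<in> V" for v
      using w[OF insert.prems(2)[OF that u(1), of "- v a"]] u(2) by simp
    then show ?thesis using wx eq by metis
  next
    case False
    show ?thesis
    proof (cases "x a = 0")
      case True
      have "\<exists>w. (\<forall>v\<in>V. (\<Sum>i\<in>I. w i * v i) = 0) \<and> (\<Sum>i\<in>I. w i * x i) \<noteq> 0"
        using insert.prems True False by (intro insert.IH) fastforce+
      then obtain w where "\<forall>v\<in>V. (\<Sum>i\<in>I. w i * v i) = 0" "(\<Sum>i\<in>I. w i * x i) \<noteq> 0" by blast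
      then show ?thesis using insert.hyps True False by (intro exI[of _ w]) simp
    next
      case xa: False
      have "(\<Sum>i\<in>insert a I. (if i = a then 1 else 0) * y i) = y a" for y :: "'i \<Rightarrow> 'a"
        using insert.hyps by (simp add: if_distrib[of "\<lambda>z. z * _"] sum.delta cong: if_cong)
      then show ?thesis using False xa by (intro exI[of _ "\<lambda>i. if i = a then 1 else 0"]) auto
    qed
  qed
qed

text \<open>A vector \<open>w\<close> orthogonal to all columns is orthogonal to their span. At full
  rank the span contains every unit vector, so \<open>w\<close> vanishes; below full rank a vector
  outside the span is separated from it by a nonzero \<open>w\<close>. This turns every rank
  condition into a statement about left kernels.\<close>

lemma rank_eq_dim_row_iff:
  fixes M :: "'a :: field mat"
  assumes M: "M \<in> carrier_mat nr nc"
  shows "vec_space.rank nr M = nr \<longleftrightarrow>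
    (\<forall>w. (\<forall>c<nc. (\<Sum>r<nr. w r * M $$ (r, c)) = 0) \<longrightarrow> (\<forall>r<nr. w r = 0))"
proof -
  interpret vec_space "TYPE('a)" nr .
  have cols: "set (cols M) \<subseteq> carrier_vec nr" using M cols_dim by blast
  show ?thesis
  proof (intro iffI allI impI)
    fix w r
    assume rk: "rank M = nr" and w: "\<forall>c<nc. (\<Sum>r<nr. w r * M $$ (r, c)) = 0" and r: "r < nr"
    \<comment> \<open>The size of a maximal independent set of columns is the rank, here the
      dimension, so \<open>S\<close> is a basis.\<close>
    obtain S where S: "finite S" "maximal S (\<lambda>T. T \<subseteq> set (cols M) \<and> lin_indpt T)"
      using maximal_exists_superset[of "set (cols M)" "\<lambda>T. T \<subseteq> set (cols M) \<and> lin_indpt T" "{}"]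
      by (auto simp: finite_lin_indpt2)
    then have SM: "S \<subseteq> set (cols M)" "lin_indpt S" by (auto simp: maximal_def)
    have "dim \<le> card S" using rank_card_indpt[OF M S(2)] rk dim_is_n by simp
    moreover have "S \<subseteq> carrier V" using SM cols by auto
    ultimately have "basis S" using SM(2) S(1) fin_dim by (intro dim_li_is_basis) simp_all
    then have "unit_vec nr r \<in> span S" by (simp add: basis_def)
    then obtain a A where A: "unit_vec nr r = lincomb a A" "finite A" "A \<subseteq> S"
      using in_spanE by blast
    have Ac: "A \<subseteq> carrier_vec nr" using A(3) SM cols by auto
    have "(\<Sum>i<nr. w i * x $ i) = 0" if "x \<in> A" for x
    proof -
      have "x \<in> set (cols M)" using that A(3) SM by auto
      then obtain c where "c < nc" "x = col M c" using M by (auto simp: cols_def)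
      then show ?thesis using w M by auto
    qed
    then have "(\<Sum>x\<in>A. a x * (\<Sum>i<nr. w i * x $ i)) = 0" by simp
    moreover have "(\<Sum>x\<in>A. a x * (\<Sum>i<nr. w i * x $ i)) = (\<Sum>i<nr. w i * lincomb a A $ i)"
      using Ac by (simp add: lincomb_index sum_distrib_left algebra_simps) (rule sum.swap)
    ultimately have "(\<Sum>i<nr. w i * unit_vec nr r $ i) = 0" by (simp add: A(1))
    then show "w r = 0"
      using r by (simp add: unit_vec_def if_distrib[of "\<lambda>z. _ * z"] sum.delta cong: if_cong)
  next
    assume *: "\<forall>w. (\<forall>c<nc. (\<Sum>r<nr. w r * M $$ (r, c)) = 0) \<longrightarrow> (\<forall>r<nr. w r = 0)"
    define W where "W = {f. vec nr f \<in> span (set (cols M))}"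
    have "x \<in> span (set (cols M))" if x: "x \<in> carrier_vec nr" for x
    proof (rule ccontr)
      assume nx: "x \<notin> span (set (cols M))"
      have "\<exists>w. (\<forall>v\<in>W. (\<Sum>i<nr. w i * v i) = 0) \<and> (\<Sum>i<nr. w i * x $ i) \<noteq> 0"
      proof (rule separating_functional)
        have "vec nr (\<lambda>_. 0 :: 'a) = 0\<^sub>v nr" by auto
        moreover have "0\<^sub>v nr \<in> span (set (cols M))"
          by (intro in_spanI[of _ "\<lambda>_. 0" "{}"]) (auto simp: lincomb_def)
        ultimately show "(\<lambda>_. 0) \<in> W" by (simp add: W_def)
      next
        fix f g t
        assume "f \<in> W" "g \<in> W"
        then have "vec nr f + t \<cdot>\<^sub>v vec nr g \<in> span (set (cols M))"
          using span_add1[OF cols, of "vec nr f" "t \<cdot>\<^sub>v vec nr g"] smult_in_span[OF cols]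
          by (auto simp: W_def)
        moreover have "vec nr f + t \<cdot>\<^sub>v vec nr g = vec nr (\<lambda>i. f i + t * g i)" by auto
        ultimately show "(\<lambda>i. f i + t * g i) \<in> W" by (simp add: W_def)
      next
        fix v
        assume v: "v \<in> W"
        show "\<exists>i\<in>{..<nr}. v i \<noteq> x $ i"
        proof (rule ccontr)
          assume "\<not> ?thesis"
          then have "x = vec nr v" using x by auto
          then show False using nx v by (simp add: W_def)
        qed
      qed auto
      then obtain w where w: "\<And>v. v \<in> W \<Longrightarrow> (\<Sum>i<nr. w i * v i) = 0"
        and wx: "(\<Sum>i<nr. w i * x $ i) \<noteq> 0" by auto
      have "(\<Sum>r<nr. w r * M $$ (r, c)) = 0" if "c < nc" for c
      proof (rule w)
        have "col M c \<in> set (cols M)" using that M by (auto simp: cols_def)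
        moreover have "vec nr (\<lambda>r. M $$ (r, c)) = col M c" using M that by auto
        ultimately show "(\<lambda>r. M $$ (r, c)) \<in> W" using span_mem[OF cols] by (auto simp: W_def)
      qed
      then have "\<forall>r<nr. w r = 0" using * by blast
      then show False using wx by simp
    qed
    then have "span (set (cols M)) = carrier_vec nr"
      using span_closed[OF cols] by auto
    then have "span_vs (set (cols M)) = V" by simp
    then show "rank M = nr" unfolding rank_def using dim_is_n by metis
  qed
qed

text \<open>For a square matrix injectivity gives surjectivity: a vector \<open>u\<close> outside
  the range would be separated from it by a nonzero \<open>y\<close> in the right kernel, so the
  determinant would vanish, and with it that of the transpose, contradicting the trivial left
  kernel.\<close>

lemma left_solvable:
  fixes M :: "nat \<Rightarrow> nat \<Rightarrow> 'a :: field"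
  assumes inj: "\<And>w. (\<And>c. c < n \<Longrightarrow> (\<Sum>r<n. w r * M r c) = 0) \<Longrightarrow> \<forall>r<n. w r = 0"
  shows "\<exists>w. \<forall>c<n. (\<Sum>r<n. w r * M r c) = u c"
proof (rule ccontr)
  assume no: "\<not> ?thesis"
  define V where "V = range (\<lambda>w c. \<Sum>r<n. w r * M r c)"
  have "\<exists>y. (\<forall>v\<in>V. (\<Sum>c<n. y c * v c) = 0) \<and> (\<Sum>c<n. y c * u c) \<noteq> 0"
  proof (rule separating_functional)
    show "(\<lambda>_. 0) \<in> V" unfolding V_def by (rule range_eqI[of _ _ "\<lambda>_. 0"]) simp
  next
    fix f g t
    assume "f \<in> V" "g \<in> V"
    then obtain p q where "f = (\<lambda>c. \<Sum>r<n. p r * M r c)" "g = (\<lambda>c. \<Sum>r<n. q r * M r c)"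
      by (auto simp: V_def)
    then have "(\<lambda>i. f i + t * g i) = (\<lambda>c. \<Sum>r<n. (p r + t * q r) * M r c)"
      by (simp add: algebra_simps sum.distrib sum_distrib_left)
    then show "(\<lambda>i. f i + t * g i) \<in> V"
      unfolding V_def by (rule range_eqI[of _ _ "\<lambda>r. p r + t * q r"])
  qed (use no in \<open>auto simp: V_def\<close>)
  then obtain y where y: "\<And>v. v \<in> V \<Longrightarrow> (\<Sum>c<n. y c * v c) = 0"
    and yu: "(\<Sum>c<n. y c * u c) \<noteq> 0" by auto
  \<comment> \<open>Row \<open>r\<close> lies in the range, being the image of a unit
    vector.\<close>
  have ker: "(\<Sum>c<n. y c * M r c) = 0" if "r < n" for r
  proof (rule y)
    have "(\<Sum>i<n. (if i = r then 1 else 0) * M i c) = M r c" for c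
      using that by (simp add: if_distrib[of "\<lambda>z. z * _"] sum.delta cong: if_cong)
    then show "(\<lambda>c. M r c) \<in> V"
      unfolding V_def by (intro range_eqI[of _ _ "\<lambda>i. if i = r then 1 else 0"]) simp
  qed
  have sp: "(mat n n (\<lambda>(i, j). N i j) *\<^sub>v v) $ i = (\<Sum>j<n. v $ j * N i j)"
    if "i < n" "v \<in> carrier_vec n" for i v and N :: "nat \<Rightarrow> nat \<Rightarrow> 'a"
    using that by (auto simp: scalar_prod_def atLeast0LessThan mult.commute intro!: sum.cong)
  have "vec n y \<noteq> 0\<^sub>v n"
  proof
    assume "vec n y = 0\<^sub>v n"
    then have "y c = 0" if "c < n" for c using that by (metis index_vec index_zero_vec(1))
    then show False using yu by simp
  qed
  moreover have "mat n n (\<lambda>(i, j). M i j) *\<^sub>v vec n y = 0\<^sub>v n"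
    using ker by (intro eq_vecI) (simp_all add: sp del: index_mult_mat_vec)
  ultimately have "det (mat n n (\<lambda>(i, j). M i j)) = 0"
    by (subst det_0_iff_vec_prod_zero_field[of _ n]) (auto intro!: exI[of _ "vec n y"])
  moreover have "transpose_mat (mat n n (\<lambda>(i, j). M i j)) = mat n n (\<lambda>(i, j). M j i)" by auto
  ultimately have "det (mat n n (\<lambda>(i, j). M j i)) = 0"
    by (metis det_transpose mat_carrier)
  then obtain v where v: "v \<in> carrier_vec n" "v \<noteq> 0\<^sub>v n" "mat n n (\<lambda>(i, j). M j i) *\<^sub>v v = 0\<^sub>v n"
    by (subst (asm) det_0_iff_vec_prod_zero_field[of _ n]) auto
  have "\<forall>r<n. v $ r = 0"
  proof (rule inj)
    show "(\<Sum>r<n. v $ r * M r c) = 0" if "c < n" for c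
      using sp[OF that v(1), of "\<lambda>i j. M j i"] v(3) that by simp
  qed
  then show False using v(1,2) by auto
qed

section \<open>Eigenvectors from linearly dependent chains\<close>

text \<open>For \<open>k = 0\<close> the sum is empty, so the condition says that \<open>w 0\<close>
  vanishes on the indices below \<open>n\<close>.\<close>

definition dep_on_earlier :: "nat \<Rightarrow> (nat \<Rightarrow> nat \<Rightarrow> real) \<Rightarrow> nat \<Rightarrow> bool" where
  "dep_on_earlier n w k \<longleftrightarrow> (\<exists>c. \<forall>r<n. w k r = (\<Sum>i<k. c i * w i r))"

text \<open>For \<open>p = (x - s) q\<close> and \<open>v\<close> the combination of the
  \<open>w i\<close> with the coefficients of \<open>q\<close>, the chain relation shifts indices
  and gives \<open>v A - s v E = (w k - (a 0 w 0 + ... + a (k - 1) w (k - 1))) E = 0\<close>. The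
  vector \<open>v\<close> is nonzero because \<open>q\<close> has a nonzero leading coefficient and
  no term before \<open>w k\<close> depends on earlier ones. A root \<open>s\<close> may be
  non-real, hence the complex coefficients.\<close>

lemma eigenvector_of_dependent_chain:
  fixes w E A :: "nat \<Rightarrow> nat \<Rightarrow> real"
  assumes chain: "\<And>j c. j < k \<Longrightarrow> c < n \<Longrightarrow> (\<Sum>r<n. w j r * A r c) = (\<Sum>r<n. w (Suc j) r * E r c)"
    and dep: "dep_on_earlier n w k" and indep: "\<And>j. j < k \<Longrightarrow> \<not> dep_on_earlier n w j"
    and k: "k > 0"
  shows "\<exists>(s :: complex) (q :: nat \<Rightarrow> complex).
    (\<exists>r<n. (\<Sum>i<k. q i * w i r) \<noteq> 0) \<and>
    (\<forall>c<n. (\<Sum>r<n. (\<Sum>i<k. q i * w i r) * (s * E r c - A r c)) = 0)"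
proof -
  obtain a where a: "\<And>r. r < n \<Longrightarrow> w k r = (\<Sum>i<k. a i * w i r)"
    using dep by (auto simp: dep_on_earlier_def)
  define p :: "complex poly" where "p = monom 1 k - (\<Sum>i<k. monom (of_real (a i)) i)"
  have cp: "coeff p i = (if i = k then 1 else if i < k then - of_real (a i) else 0)" for i
    by (auto simp: p_def coeff_sum)
  have "degree p = k"
    by (intro antisym degree_le le_degree) (auto simp: cp)
  then obtain s where "poly p s = 0"
    using k fundamental_theorem_of_algebra[of p] by (auto simp: constant_degree)
  then obtain q where q: "p = [:- s, 1:] * q" by (auto simp: poly_eq_0_iff_dvd dvd_def)
  have q0: "q \<noteq> 0" using \<open>degree p = k\<close> k q by auto
  have "degree q + 1 = k"
    using q0 \<open>degree p = k\<close> unfolding q by (subst (asm) degree_mult_eq) auto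
  then have dq: "degree q = k - 1" by simp
  have cq: "coeff p i = (case i of 0 \<Rightarrow> 0 | Suc j \<Rightarrow> coeff q j) - s * coeff q i" for i
    by (simp add: q coeff_pCons split: nat.split)
  have qk: "coeff q k = 0" using dq k by (simp add: coeff_eq_0)
  \<comment> \<open>Both sides are the image of \<open>p\<close> under the linear map sending
    \<open>x ^ i\<close> to \<open>e i\<close>, once for the factored and once for the expanded form
    of \<open>p\<close>.\<close>
  have ident: "(\<Sum>i<k. coeff q i * e (Suc i)) - s * (\<Sum>i<k. coeff q i * e i)
      = e k - (\<Sum>i<k. of_real (a i) * e i)" for e :: "nat \<Rightarrow> complex"
  proof -
    have "(\<Sum>i\<le>k. coeff p i * e i) = e k - (\<Sum>i<k. of_real (a i) * e i)"
      by (simp add: cp lessThan_Suc_atMost[symmetric] sum_negf)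
    moreover have "(\<Sum>i\<le>k. (case i of 0 \<Rightarrow> 0 | Suc j \<Rightarrow> coeff q j) * e i)
        = (\<Sum>i<k. coeff q i * e (Suc i))"
      by (subst sum.atMost_shift) simp
    then have "(\<Sum>i\<le>k. coeff p i * e i)
        = (\<Sum>i<k. coeff q i * e (Suc i)) - s * (\<Sum>i\<le>k. coeff q i * e i)"
      by (simp add: cq sum_subtractf sum_distrib_left algebra_simps)
    moreover have "(\<Sum>i\<le>k. coeff q i * e i) = (\<Sum>i<k. coeff q i * e i)"
      by (simp add: lessThan_Suc_atMost[symmetric] qk)
    ultimately show ?thesis by simp
  qed
  define v where "v = (\<lambda>r. \<Sum>i<k. coeff q i * w i r)"
  have "(\<Sum>r<n. v r * (s * E r c - A r c)) = 0" if c: "c < n" for c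
  proof -
    \<comment> \<open>\<open>e i\<close> is entry \<open>c\<close> of the row vector
      \<open>w i E\<close>; by the chain relation \<open>e (Suc i)\<close> is entry \<open>c\<close>
      of \<open>w i A\<close>.\<close>
    define e where "e = (\<lambda>i. complex_of_real (\<Sum>r<n. w i r * E r c))"
    have "(\<Sum>r<n. v r * E r c) = (\<Sum>i<k. coeff q i * e i)"
      unfolding v_def e_def sum_distrib_right of_real_sum sum_distrib_left
      by (subst sum.swap) (simp add: algebra_simps)
    moreover have "(\<Sum>r<n. v r * A r c) = (\<Sum>i<k. coeff q i * of_real (\<Sum>r<n. w i r * A r c))"
      unfolding v_def sum_distrib_right of_real_sum sum_distrib_left
      by (subst sum.swap) (simp add: algebra_simps)
    then have "(\<Sum>r<n. v r * A r c) = (\<Sum>i<k. coeff q i * e (Suc i))"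
      using chain[OF _ c] by (simp add: e_def del: of_real_sum)
    moreover have "e k = (\<Sum>i<k. of_real (a i) * e i)"
    proof -
      have "(\<Sum>r<n. w k r * E r c) = (\<Sum>i<k. a i * (\<Sum>r<n. w i r * E r c))"
        unfolding sum_distrib_left
        by (subst sum.swap) (simp add: a sum_distrib_right sum_distrib_left algebra_simps)
      then show ?thesis unfolding e_def by simp
    qed
    ultimately show ?thesis
      using ident[of e] by (simp add: algebra_simps sum_subtractf flip: sum_distrib_left)
  qed
  moreover have "\<exists>r<n. v r \<noteq> 0"
  proof (rule ccontr)
    assume "\<not> ?thesis"
    then have v0: "v r = 0" if "r < n" for r using that by auto
    obtain l where l: "k = Suc l" using k by (cases k) auto
    have ql: "coeff q l \<noteq> 0" using q0 dq l by (metis diff_Suc_1 leading_coeff_0_iff)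
    \<comment> \<open>Solving \<open>v = 0\<close> for the last term gives a relation with complex
      coefficients between real vectors; its real part is a real relation.\<close>
    have "w l r = (\<Sum>i<l. Re (- coeff q i / coeff q l) * w i r)" if "r < n" for r
    proof -
      have "complex_of_real (w l r) = (\<Sum>i<l. (- coeff q i / coeff q l) * w i r)"
        using v0[OF that] ql
        by (simp add: v_def l sum_negf field_simps add_eq_0_iff flip: sum_divide_distrib)
      then have "Re (complex_of_real (w l r)) = Re (\<Sum>i<l. (- coeff q i / coeff q l) * w i r)"
        by simp
      then show ?thesis by (simp only: Re_sum times_complex.simps Re_complex_of_real Im_complex_of_real) simp
    qed
    then have "dep_on_earlier n w l"
      unfolding dep_on_earlier_def by (intro exI[of _ "\<lambda>i. Re (- coeff q i / coeff q l)"]) simp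
    then show False using indep l by simp
  qed
  ultimately show ?thesis unfolding v_def by blast
qed

section \<open>Chains and C-controllability\<close>

text \<open>The first condition stops at \<open>j < n - 1\<close> because the last block column of
  \<open>ctrb_mat\<close> contains only \<open>B\<close>; the term \<open>w (n - 1)\<close> is never
  multiplied by \<open>A\<close>.\<close>

definition left_chain :: "nat \<Rightarrow> nat \<Rightarrow> real mat \<Rightarrow> real mat \<Rightarrow> real mat \<Rightarrow> (nat \<Rightarrow> nat \<Rightarrow> real) \<Rightarrow> bool" where
  "left_chain n m E A B w \<longleftrightarrow>
     (\<forall>j<n - 1. \<forall>c<n. (\<Sum>r<n. w j r * A $$ (r, c)) = (\<Sum>r<n. w (Suc j) r * E $$ (r, c))) \<and>
     (\<forall>j<n. \<forall>c<m. (\<Sum>r<n. w j r * B $$ (r, c)) = 0)"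

lemma append_cols_carrier:
  "X \<in> carrier_mat n a \<Longrightarrow> Y \<in> carrier_mat n b \<Longrightarrow> X @\<^sub>c Y \<in> carrier_mat n (a + b)"
  unfolding append_cols_def by auto

lemma append_cols_index:
  assumes "X \<in> carrier_mat n a" "Y \<in> carrier_mat n b" "i < n" "j < a + b"
  shows "(X @\<^sub>c Y) $$ (i, j) = (if j < a then X $$ (i, j) else Y $$ (i, j - a))"
  using assms unfolding append_cols_def by auto

lemma all_less_add: "(\<forall>c<a + b. P c) \<longleftrightarrow> (\<forall>c<a. P c) \<and> (\<forall>c<b. P (a + c))" for a b :: nat
  by (metis le_iff_add nat_add_left_cancel_less not_le trans_less_add1)

lemma rank_append_cols_iff:
  fixes X :: "'a :: field mat"
  assumes "X \<in> carrier_mat n a" "Y \<in> carrier_mat n b"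
  shows "vec_space.rank n (X @\<^sub>c Y) = n \<longleftrightarrow>
    (\<forall>w. (\<forall>c<a. (\<Sum>r<n. w r * X $$ (r, c)) = 0) \<and> (\<forall>c<b. (\<Sum>r<n. w r * Y $$ (r, c)) = 0)
      \<longrightarrow> (\<forall>r<n. w r = 0))"
  using assms
  by (subst rank_eq_dim_row_iff[OF append_cols_carrier[OF assms]])
     (simp add: all_less_add append_cols_index)

text \<open>At a finite \<open>s\<close> the complex chain \<open>s ^ j v\<close> satisfies linear
  equations with real coefficients, so its real and imaginary parts are chains as well. Its term at
  \<open>j = 0\<close> is \<open>v\<close> itself, also when \<open>s = 0\<close>, so one of the two
  parts is nonzero.\<close>

lemma uncontrollable_imp_left_chain:
  assumes E: "E \<in> carrier_mat n n" and A: "A \<in> carrier_mat n n" and B: "B \<in> carrier_mat n m"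
    and "\<not> C_controllable n E A B"
  shows "\<exists>w. left_chain n m E A B w \<and> (\<exists>j<n. \<exists>r<n. w j r \<noteq> 0)"
proof -
  consider (fin) s where "vec_space.rank n
        ((s \<cdot>\<^sub>m map_mat complex_of_real E - map_mat complex_of_real A)
           @\<^sub>c map_mat complex_of_real B) \<noteq> n"
    | (inf) "vec_space.rank n (E @\<^sub>c B) \<noteq> n"
    using assms(4) by (auto simp: C_controllable_def)
  then show ?thesis
  proof cases
    case fin
    have "(s \<cdot>\<^sub>m map_mat complex_of_real E - map_mat complex_of_real A) \<in> carrier_mat n n"
      "map_mat complex_of_real B \<in> carrier_mat n m" using E A B by auto
    from fin[unfolded rank_append_cols_iff[OF this]]
    obtain v r0 where v: "\<And>c. c < n \<Longrightarrow> (\<Sum>r<n. v r * (s * E $$ (r, c) - A $$ (r, c))) = 0"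
      "\<And>c. c < m \<Longrightarrow> (\<Sum>r<n. v r * B $$ (r, c)) = 0" "r0 < n" "v r0 \<noteq> 0"
      using E A B by auto
    have vA: "(\<Sum>r<n. s ^ j * v r * A $$ (r, c)) = (\<Sum>r<n. s ^ Suc j * v r * E $$ (r, c))"
      if "c < n" for c j
      using arg_cong[OF v(1)[OF that], of "\<lambda>z. s ^ j * z"]
      by (simp add: algebra_simps sum_subtractf sum_distrib_left)
    have vB: "(\<Sum>r<n. s ^ j * v r * B $$ (r, c)) = 0" if "c < m" for c j
      using arg_cong[OF v(2)[OF that], of "\<lambda>z. s ^ j * z"]
      by (simp add: algebra_simps sum_distrib_left)
    have Re: "left_chain n m E A B (\<lambda>j r. Re (s ^ j * v r))"
      unfolding left_chain_def
    proof (intro conjI allI impI, goal_cases)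
      case (1 j c)
      then show ?case using arg_cong[OF vA, of c Re j] by (simp del: power_Suc)
    next
      case (2 j c)
      then show ?case using arg_cong[OF vB, of c Re j] by simp
    qed
    have Im: "left_chain n m E A B (\<lambda>j r. Im (s ^ j * v r))"
      unfolding left_chain_def
    proof (intro conjI allI impI, goal_cases)
      case (1 j c)
      then show ?case using arg_cong[OF vA, of c Im j] by (simp del: power_Suc)
    next
      case (2 j c)
      then show ?case using arg_cong[OF vB, of c Im j] by simp
    qed
    have "Re (v r0) \<noteq> 0 \<or> Im (v r0) \<noteq> 0" using v(4) by (auto simp: complex_eq_iff)
    then have "Re (s ^ 0 * v r0) \<noteq> 0 \<or> Im (s ^ 0 * v r0) \<noteq> 0" by simp
    moreover have "0 < n" using v(3) by simp
    ultimately show ?thesis using v(3) Re Im by blast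
  next
    case inf
    then obtain v r0 where v: "\<And>c. c < n \<Longrightarrow> (\<Sum>r<n. v r * E $$ (r, c)) = 0"
      "\<And>c. c < m \<Longrightarrow> (\<Sum>r<n. v r * B $$ (r, c)) = 0" "r0 < n" "v r0 \<noteq> 0"
      unfolding rank_append_cols_iff[OF E B] by auto
    \<comment> \<open>The last term of a chain is constrained only through \<open>E\<close> and
      \<open>B\<close>, which \<open>v\<close> annihilates.\<close>
    define w where "w = (\<lambda>j. if j = n - 1 then v else (\<lambda>_. 0))"
    have "left_chain n m E A B w"
      using v(1,2) by (auto simp: left_chain_def w_def)
    moreover have "w (n - 1) r0 \<noteq> 0" "n - 1 < n" using v(3,4) by (auto simp: w_def)
    ultimately show ?thesis using v(3) by blast
  qed
qed

text \<open>The last nonzero coefficient of a linear relation would make its term dependent on the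
  earlier ones.\<close>

lemma independent_imp_injective:
  assumes indep: "\<And>j. j < n \<Longrightarrow> \<not> dep_on_earlier N w j"
    and x: "\<And>c. c < N \<Longrightarrow> (\<Sum>r<n. x r * w r c) = 0"
  shows "\<forall>r<n. x r = 0"
proof (rule ccontr)
  assume "\<not> ?thesis"
  then have ne: "\<exists>l. l < n \<and> x l \<noteq> 0" by auto
  define l where "l = (GREATEST l. l < n \<and> x l \<noteq> 0)"
  have l: "l < n" "x l \<noteq> 0"
    using GreatestI_ex_nat[of "\<lambda>l. l < n \<and> x l \<noteq> 0" n] ne unfolding l_def by auto
  have z: "x r = 0" if "l < r" "r < n" for r
    using Greatest_le_nat[of "\<lambda>l. l < n \<and> x l \<noteq> 0" r n] that unfolding l_def by force
  have "w l c = (\<Sum>i<l. (- x i / x l) * w i c)" if "c < N" for c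
  proof -
    have "0 = (\<Sum>r<n. x r * w r c)" using x that by simp
    also have "\<dots> = (\<Sum>r<Suc l. x r * w r c)"
      using l z by (intro sum.mono_neutral_right) auto
    finally show ?thesis
      using l(2) by (simp add: sum_negf field_simps add_eq_0_iff flip: sum_divide_distrib)
  qed
  then have "dep_on_earlier N w l"
    unfolding dep_on_earlier_def by (intro exI[of _ "\<lambda>i. - x i / x l"]) simp
  then show False using indep[OF l(1)] by blast
qed

text \<open>Controllability at infinity makes \<open>v\<close> determined by \<open>v E\<close> and
  \<open>v B\<close>; this forces \<open>w 0\<close> to be nonzero and, if the chain is independent,
  allows it to be prolonged. The first dependent term then yields an eigenvector annihilating
  \<open>B\<close>, against controllability at the finite \<open>s\<close>.\<close>

lemma left_chain_imp_uncontrollable: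
  assumes E: "E \<in> carrier_mat n n" and A: "A \<in> carrier_mat n n" and B: "B \<in> carrier_mat n m"
    and chain: "left_chain n m E A B w" and nz: "\<exists>j<n. \<exists>r<n. w j r \<noteq> 0"
  shows "\<not> C_controllable n E A B"
proof
  assume contr: "C_controllable n E A B"
  have wA: "(\<Sum>r<n. w j r * A $$ (r, c)) = (\<Sum>r<n. w (Suc j) r * E $$ (r, c))"
    if "j < n - 1" "c < n" for j c
    using chain that by (auto simp: left_chain_def)
  have wB: "(\<Sum>r<n. w j r * B $$ (r, c)) = 0" if "j < n" "c < m" for j c
    using chain that by (auto simp: left_chain_def)
  have infty: "\<forall>r<n. v r = 0"
    if "\<And>c. c < n \<Longrightarrow> (\<Sum>r<n. v r * E $$ (r, c)) = 0" "\<And>c. c < m \<Longrightarrow> (\<Sum>r<n. v r * B $$ (r, c)) = 0" for v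
  proof -
    have "vec_space.rank n (E @\<^sub>c B) = n" using contr unfolding C_controllable_def by blast
    from spec[OF this[unfolded rank_append_cols_iff[OF E B]], of v] that show ?thesis by blast
  qed
  \<comment> \<open>If \<open>w 0\<close> vanished, then \<open>w 1 E = w 0 A = 0\<close> and
    \<open>w 1 B = 0\<close> would give \<open>w 1 = 0\<close>, and so on along the whole
    chain.\<close>
  have w0: "\<exists>r<n. w 0 r \<noteq> 0"
  proof (rule ccontr)
    assume *: "\<not> ?thesis"
    have "j < n \<Longrightarrow> \<forall>r<n. w j r = 0" for j
    proof (induction j)
      case (Suc j)
      then show ?case using wA[of j] wB[of "Suc j"] by (intro infty) auto
    qed (use * in auto)
    then show False using nz by auto
  qed
  \<comment> \<open>If the chain is independent, it spans everything; then \<open>B = 0\<close>, \<open>E\<close> is invertible, and one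
      further (necessarily dependent) term \<open>w n\<close> can be appended to the chain.\<close>
  have "\<exists>w' k. dep_on_earlier n w' k \<and> (\<forall>j<k. \<not> dep_on_earlier n w' j) \<and>
      (\<forall>j<k. \<forall>c<n. (\<Sum>r<n. w' j r * A $$ (r, c)) = (\<Sum>r<n. w' (Suc j) r * E $$ (r, c))) \<and>
      (\<forall>j<k. \<forall>c<m. (\<Sum>r<n. w' j r * B $$ (r, c)) = 0) \<and> w' 0 = w 0"
  proof (cases "\<exists>k<n. dep_on_earlier n w k")
    case True
    define k where "k = (LEAST k. dep_on_earlier n w k)"
    obtain k' where k': "k' < n" "dep_on_earlier n w k'" using True by blast
    have k: "dep_on_earlier n w k" unfolding k_def using k'(2) by (rule LeastI)
    have min: "\<not> dep_on_earlier n w j" if "j < k" for j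
      using that unfolding k_def by (rule not_less_Least)
    have "k \<le> k'" unfolding k_def using k'(2) by (rule Least_le)
    then have "k < n" using k'(1) by simp
    then show ?thesis using k min wA wB by (intro exI[of _ w] exI[of _ k]) simp
  next
    case False
    \<comment> \<open>The \<open>n\<close> independent terms are the rows of an invertible
      matrix.\<close>
    have span: "\<exists>a. \<forall>r<n. (\<Sum>i<n. a i * w i r) = u r" for u
      using False independent_imp_injective[of n n w] by (intro left_solvable) blast
    have "B $$ (r, c) = 0" if rc: "r < n" "c < m" for r c
    proof -
      \<comment> \<open>Writing the unit vector \<open>r\<close> as a combination of the chain
        extracts row \<open>r\<close> of \<open>B\<close> from the equations
        \<open>w j B = 0\<close>.\<close>
      obtain a where a: "\<And>i. i < n \<Longrightarrow> (\<Sum>j<n. a j * w j i) = (if i = r then 1 else 0)"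
        using span[of "\<lambda>i. if i = r then 1 else 0"] by auto
      have "(\<Sum>j<n. a j * (\<Sum>i<n. w j i * B $$ (i, c))) = 0" using wB rc by simp
      also have "(\<Sum>j<n. a j * (\<Sum>i<n. w j i * B $$ (i, c))) = (\<Sum>i<n. (\<Sum>j<n. a j * w j i) * B $$ (i, c))"
        unfolding sum_distrib_left sum_distrib_right by (subst sum.swap) (simp add: algebra_simps)
      also have "\<dots> = (\<Sum>i<n. (if i = r then 1 else 0) * B $$ (i, c))"
        by (intro sum.cong) (auto simp: a)
      also have "\<dots> = B $$ (r, c)"
        using rc by (simp add: if_distrib[of "\<lambda>z. z * _"] sum.delta cong: if_cong)
      finally show ?thesis .
    qed
    then have "\<exists>y. \<forall>c<n. (\<Sum>r<n. y r * E $$ (r, c)) = (\<Sum>r<n. w (n - 1) r * A $$ (r, c))"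
      by (intro left_solvable infty) auto
    then obtain y where y: "\<And>c. c < n \<Longrightarrow> (\<Sum>r<n. y r * E $$ (r, c)) = (\<Sum>r<n. w (n - 1) r * A $$ (r, c))"
      by blast
    define w' where "w' = w(n := y)"
    have w': "w' j = w j" if "j < n" for j using that by (simp add: w'_def)
    have "n > 0" using nz by auto
    have same: "dep_on_earlier n w' j = dep_on_earlier n w j" if "j < n" for j
      using that by (simp add: dep_on_earlier_def w')
    obtain a where "\<And>r. r < n \<Longrightarrow> (\<Sum>i<n. a i * w i r) = y r" using span[of y] by auto
    then have "dep_on_earlier n w' n"
      unfolding dep_on_earlier_def by (intro exI[of _ a]) (simp add: w'_def)
    moreover have "(\<Sum>r<n. w' j r * A $$ (r, c)) = (\<Sum>r<n. w' (Suc j) r * E $$ (r, c))"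
      if "j < n" "c < n" for j c
    proof (cases "Suc j = n")
      case True
      then have "j = n - 1" by simp
      then show ?thesis using y[OF that(2)] w'[OF that(1)] True by (simp add: w'_def)
    next
      case False
      then show ?thesis using wA[of j c] that by (simp add: w')
    qed
    ultimately show ?thesis
      using False same wB w' \<open>n > 0\<close> by (intro exI[of _ w'] exI[of _ n]) auto
  qed
  then obtain w' k where k: "dep_on_earlier n w' k" "\<And>j. j < k \<Longrightarrow> \<not> dep_on_earlier n w' j"
    "\<And>j c. j < k \<Longrightarrow> c < n \<Longrightarrow> (\<Sum>r<n. w' j r * A $$ (r, c)) = (\<Sum>r<n. w' (Suc j) r * E $$ (r, c))"
    and w'B: "\<And>j c. j < k \<Longrightarrow> c < m \<Longrightarrow> (\<Sum>r<n. w' j r * B $$ (r, c)) = 0" and "w' 0 = w 0"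
    by blast
  \<comment> \<open>Dependence at index 0 would mean that \<open>w 0\<close> vanishes.\<close>
  have "k > 0"
    using k(1) w0 \<open>w' 0 = w 0\<close> by (cases k) (auto simp: dep_on_earlier_def)
  obtain s q where q: "\<exists>r<n. (\<Sum>i<k. q i * complex_of_real (w' i r)) \<noteq> 0"
    "\<And>c. c < n \<Longrightarrow> (\<Sum>r<n. (\<Sum>i<k. q i * w' i r) * (s * complex_of_real (E $$ (r, c)) - A $$ (r, c))) = 0"
    using eigenvector_of_dependent_chain[where E = "\<lambda>r c. E $$ (r, c)" and A = "\<lambda>r c. A $$ (r, c)",
        OF k(3,1,2) \<open>k > 0\<close>] by blast
  define v where "v = (\<lambda>r. \<Sum>i<k. q i * complex_of_real (w' i r))"
  have vB: "(\<Sum>r<n. v r * B $$ (r, c)) = 0" if "c < m" for c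
  proof -
    have "(\<Sum>r<n. v r * B $$ (r, c)) = (\<Sum>i<k. q i * of_real (\<Sum>r<n. w' i r * B $$ (r, c)))"
      unfolding v_def sum_distrib_right of_real_sum sum_distrib_left
      by (subst sum.swap) (simp add: algebra_simps)
    then show ?thesis using w'B that by simp
  qed
  have cc: "(s \<cdot>\<^sub>m map_mat complex_of_real E - map_mat complex_of_real A) \<in> carrier_mat n n"
    "map_mat complex_of_real B \<in> carrier_mat n m" using E A B by auto
  have "\<forall>w. (\<forall>c<n. (\<Sum>r<n. w r * (s \<cdot>\<^sub>m map_mat complex_of_real E - map_mat complex_of_real A) $$ (r, c)) = 0) \<and>
      (\<forall>c<m. (\<Sum>r<n. w r * map_mat complex_of_real B $$ (r, c)) = 0) \<longrightarrow> (\<forall>r<n. w r = 0)"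
    using contr rank_append_cols_iff[OF cc] unfolding C_controllable_def by blast
  moreover have "(\<Sum>r<n. v r * (s \<cdot>\<^sub>m map_mat complex_of_real E - map_mat complex_of_real A) $$ (r, c)) = 0"
    if "c < n" for c
  proof -
    have "(\<Sum>r<n. v r * (s \<cdot>\<^sub>m map_mat complex_of_real E - map_mat complex_of_real A) $$ (r, c)) =
        (\<Sum>r<n. v r * (s * complex_of_real (E $$ (r, c)) - A $$ (r, c)))"
      using E A that by (intro sum.cong) auto
    then show ?thesis using q(2)[OF that] by (simp only: v_def)
  qed
  moreover have "(\<Sum>r<n. v r * map_mat complex_of_real B $$ (r, c)) = 0" if "c < m" for c
  proof -
    have "(\<Sum>r<n. v r * map_mat complex_of_real B $$ (r, c)) = (\<Sum>r<n. v r * B $$ (r, c))"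
      using B that by (intro sum.cong) auto
    then show ?thesis using vB[OF that] by simp
  qed
  ultimately have "\<forall>r<n. v r = 0" by blast
  then show False using q(1) by (auto simp only: v_def)
qed

section \<open>The left kernel of the block Toeplitz matrix\<close>

lemma sum_lessThan_mult:
  fixes f :: "nat \<Rightarrow> 'a :: comm_monoid_add"
  shows "(\<Sum>i<N * n. f i) = (\<Sum>p<N. \<Sum>r<n. f (p * n + r))"
proof (induction N)
  case (Suc N)
  have "(\<Sum>i<k + l. f i) = (\<Sum>i<k. f i) + (\<Sum>r<l. f (k + r))" for k l
    by (induction l) (simp_all add: add.assoc)
  from this[of "N * n" n] have "(\<Sum>i<Suc N * n. f i) = (\<Sum>i<N * n. f i) + (\<Sum>r<n. f (N * n + r))"
    by (simp add: add.commute)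
  then show ?case using Suc by simp
qed simp

text \<open>Cutting \<open>u\<close> into \<open>n\<close> blocks \<open>w p\<close> of length
  \<open>n\<close>, block column \<open>q < n - 1\<close> contributes
  \<open>w (q + 1) E - w q A\<close> in its first \<open>n\<close> columns and \<open>w q B\<close>
  in the other \<open>m\<close>, and the last block column contributes
  \<open>w (n - 1) B\<close>.\<close>

lemma left_kernel_ctrb_mat_iff:
  assumes E: "E \<in> carrier_mat n n" and A: "A \<in> carrier_mat n n" and B: "B \<in> carrier_mat n m"
  shows "(\<forall>j<n * (n + m - 1). (\<Sum>i<n\<^sup>2. u i * ctrb_mat n m E A B $$ (i, j)) = 0) \<longleftrightarrow>
    left_chain n m E A B (\<lambda>p r. u (p * n + r))"
\<comment> \<open>With truncated subtraction the width formula \<open>size\<close> below holds only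
  for positive \<open>n\<close>; for \<open>n = 0\<close> both sides are vacuous.\<close>
proof (cases "n = 0")
  case True
  then show ?thesis by (simp add: left_chain_def)
next
  case False
  then have n: "n > 0" by simp
  let ?w = "\<lambda>p r. u (p * n + r)"
  have size: "n * (n + m - 1) = (n - 1) * (n + m) + m"
    using n by (cases n) (auto simp: algebra_simps)
  have mA: "- A \<in> carrier_mat n n" and z: "0\<^sub>m n m \<in> carrier_mat n m" using A by auto
  have entry: "ctrb_mat n m E A B $$ (p * n + r, q * (n + m) + c) =
      (if q < n - 1 then
         (if p = q then (- A @\<^sub>c B) $$ (r, c)
          else if p = q + 1 then (E @\<^sub>c 0\<^sub>m n m) $$ (r, c) else 0)
       else (if p = n - 1 then B $$ (r, c) else 0))"
    if "p < n" "r < n" "c < n + m" "q * (n + m) + c < n * (n + m - 1)" for p r q c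
  proof -
    have "p * n + r < Suc p * n" using that by simp
    also have "\<dots> \<le> n * n" using that by (intro mult_right_mono) auto
    finally have "p * n + r < n\<^sup>2" by (simp add: power2_eq_square)
    moreover have "(p * n + r) div n = p" "(p * n + r) mod n = r"
      "(q * (n + m) + c) div (n + m) = q" "(q * (n + m) + c) mod (n + m) = c"
      using that by auto
    ultimately show ?thesis
      using that(4) by (simp only: ctrb_mat_def index_mat(1) Let_def split)
  qed
  have sum_split: "(\<Sum>i<n\<^sup>2. u i * f i) = (\<Sum>p<n. \<Sum>r<n. ?w p r * f (p * n + r))" for f
    unfolding power2_eq_square by (rule sum_lessThan_mult)
  \<comment> \<open>Only block rows \<open>q\<close> and \<open>Suc q\<close> meet this block
    column, and \<open>Suc q < n\<close> since \<open>q < n - 1\<close>.\<close>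
  have blk: "(\<Sum>i<n\<^sup>2. u i * ctrb_mat n m E A B $$ (i, q * (n + m) + c)) =
      (\<Sum>r<n. ?w q r * (- A @\<^sub>c B) $$ (r, c)) + (\<Sum>r<n. ?w (Suc q) r * (E @\<^sub>c 0\<^sub>m n m) $$ (r, c))"
    if q: "q < n - 1" and c: "c < n + m" for q c
  proof -
    have "q * (n + m) + c < Suc q * (n + m)" using c by simp
    also have "\<dots> \<le> (n - 1) * (n + m)" using q by (intro mult_right_mono) auto
    finally have lt: "q * (n + m) + c < n * (n + m - 1)" unfolding size by (rule trans_less_add1)
    have "(\<Sum>i<n\<^sup>2. u i * ctrb_mat n m E A B $$ (i, q * (n + m) + c)) =
       (\<Sum>p<n. (if p = q then (\<Sum>r<n. ?w q r * (- A @\<^sub>c B) $$ (r, c)) else 0) +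
              (if p = Suc q then (\<Sum>r<n. ?w (Suc q) r * (E @\<^sub>c 0\<^sub>m n m) $$ (r, c)) else 0))"
      unfolding sum_split using q c lt by (intro sum.cong refl) (auto simp: entry)
    then show ?thesis using q by (simp add: sum.distrib)
  qed
  have lastblk: "(\<Sum>i<n\<^sup>2. u i * ctrb_mat n m E A B $$ (i, (n - 1) * (n + m) + c)) =
      (\<Sum>r<n. ?w (n - 1) r * B $$ (r, c))" if c: "c < m" for c
  proof -
    have "(\<Sum>i<n\<^sup>2. u i * ctrb_mat n m E A B $$ (i, (n - 1) * (n + m) + c)) =
       (\<Sum>p<n. if p = n - 1 then (\<Sum>r<n. ?w (n - 1) r * B $$ (r, c)) else 0)"
      unfolding sum_split using c size by (intro sum.cong refl) (auto simp: entry)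
    then show ?thesis using n by simp
  qed
  have blkA: "(\<Sum>i<n\<^sup>2. u i * ctrb_mat n m E A B $$ (i, q * (n + m) + c)) =
      (\<Sum>r<n. ?w (Suc q) r * E $$ (r, c)) - (\<Sum>r<n. ?w q r * A $$ (r, c))"
    if "q < n - 1" "c < n" for q c
    using that E A B by (simp add: blk append_cols_index[OF mA B] append_cols_index[OF E z] sum_negf)
  have blkB: "(\<Sum>i<n\<^sup>2. u i * ctrb_mat n m E A B $$ (i, q * (n + m) + (n + c))) =
      (\<Sum>r<n. ?w q r * B $$ (r, c))"
    if "q < n - 1" "c < m" for q c
    using that E A B by (simp add: blk append_cols_index[OF mA B] append_cols_index[OF E z])
  show ?thesis
  proof
    assume L: "\<forall>j<n * (n + m - 1). (\<Sum>i<n\<^sup>2. u i * ctrb_mat n m E A B $$ (i, j)) = 0"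
    have L': "(\<Sum>i<n\<^sup>2. u i * ctrb_mat n m E A B $$ (i, q * (n + m) + c)) = 0"
      if "q < n - 1" "c < n + m" for q c
    proof -
      have "q * (n + m) + c < Suc q * (n + m)" using that by simp
      also have "\<dots> \<le> (n - 1) * (n + m)" using that by (intro mult_right_mono) auto
      finally show ?thesis using L size by simp
    qed
    show "left_chain n m E A B ?w"
      unfolding left_chain_def
    proof (intro conjI allI impI)
      fix j c assume "j < n - 1" "c < n"
      then show "(\<Sum>r<n. ?w j r * A $$ (r, c)) = (\<Sum>r<n. ?w (Suc j) r * E $$ (r, c))"
        using L'[of j c] blkA[of j c] by simp
    next
      fix j c assume jc: "j < n" "c < m"
      show "(\<Sum>r<n. ?w j r * B $$ (r, c)) = 0"
      proof (cases "j = n - 1")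
        case True
        then show ?thesis using L size lastblk[OF jc(2)] jc(2) by simp
      next
        case False
        then show ?thesis using L'[of j "n + c"] blkB[of j c] jc by simp
      qed
    qed
  next
    assume R: "left_chain n m E A B ?w"
    show "\<forall>j<n * (n + m - 1). (\<Sum>i<n\<^sup>2. u i * ctrb_mat n m E A B $$ (i, j)) = 0"
    proof (intro allI impI)
      fix j assume j: "j < n * (n + m - 1)"
      define q c where "q = j div (n + m)" and "c = j mod (n + m)"
      have jqc: "j = q * (n + m) + c" unfolding q_def c_def by (rule div_mult_mod_eq[symmetric])
      have c: "c < n + m" using n by (simp add: c_def)
      show "(\<Sum>i<n\<^sup>2. u i * ctrb_mat n m E A B $$ (i, j)) = 0"
      proof (cases "q < n - 1")
        case q: True
        show ?thesis
        proof (cases "c < n")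
          case True
          then show ?thesis using R blkA[OF q True] q by (simp add: left_chain_def jqc)
        next
          case False
          then obtain c' where "c = n + c'" "c' < m" using c by (metis le_iff_add nat_add_left_cancel_less not_less)
          then show ?thesis using R blkB[OF q, of c'] q by (simp add: left_chain_def jqc)
        qed
      next
        case False
        \<comment> \<open>The total width is at most \<open>n * (n + m)\<close>, so no block column
          lies beyond \<open>n - 1\<close>; in that one, \<open>size\<close> leaves only
          \<open>c < m\<close>.\<close>
        have "q \<le> n - 1"
        proof (rule ccontr)
          assume "\<not> ?thesis"
          then have "n * (n + m) \<le> q * (n + m)" using n by (intro mult_right_mono) auto
          also have "\<dots> \<le> j" by (simp add: jqc)
          also note j
          also have "n * (n + m - 1) \<le> n * (n + m)" by simp
          finally show False by simp
        qed
        then have q: "q = n - 1" using False by simp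
        then have "c < m" using j jqc size by simp
        then show ?thesis using R lastblk[of c] n q by (simp add: left_chain_def jqc)
      qed
    qed
  qed
qed

lemma ctrb_mat_rank_deficient_iff:
  assumes "E \<in> carrier_mat n n" "A \<in> carrier_mat n n" "B \<in> carrier_mat n m"
  shows "\<not> full_row_rank (ctrb_mat n m E A B) \<longleftrightarrow>
    (\<exists>w. left_chain n m E A B w \<and> (\<exists>j<n. \<exists>r<n. w j r \<noteq> 0))"
proof -
  have C: "ctrb_mat n m E A B \<in> carrier_mat (n\<^sup>2) (n * (n + m - 1))" by (simp add: ctrb_mat_def)
  then have "dim_row (ctrb_mat n m E A B) = n\<^sup>2" by simp
  then have "\<not> full_row_rank (ctrb_mat n m E A B) \<longleftrightarrow>
      (\<exists>u. left_chain n m E A B (\<lambda>p r. u (p * n + r)) \<and> (\<exists>i<n\<^sup>2. u i \<noteq> 0))"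
    unfolding full_row_rank_def
    by (simp only: rank_eq_dim_row_iff[OF C] left_kernel_ctrb_mat_iff[OF assms]) blast
  also have "\<dots> \<longleftrightarrow> (\<exists>w. left_chain n m E A B w \<and> (\<exists>j<n. \<exists>r<n. w j r \<noteq> 0))"
  proof safe
    fix u :: "nat \<Rightarrow> real" and i
    assume u: "left_chain n m E A B (\<lambda>p r. u (p * n + r))" "i < n\<^sup>2" "u i \<noteq> 0"
    then have "n > 0" by (cases n) auto
    then have "i div n < n" "i mod n < n" using u(2)
      by (auto simp: power2_eq_square less_mult_imp_div_less)
    moreover have "u (i div n * n + i mod n) \<noteq> 0" using u(3) by simp
    ultimately show "\<exists>w. left_chain n m E A B w \<and> (\<exists>j<n. \<exists>r<n. w j r \<noteq> 0)"
      using u(1) by (intro exI[of _ "\<lambda>p r. u (p * n + r)"]) blast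
  next
    fix w :: "nat \<Rightarrow> nat \<Rightarrow> real" and j r
    assume w: "left_chain n m E A B w" and jr: "j < n" "r < n" "w j r \<noteq> 0"
    \<comment> \<open>The concatenation of the chain. It returns \<open>w p r\<close> only for
      \<open>r < n\<close>, which is all that \<open>left_chain\<close> looks at.\<close>
    define u where "u = (\<lambda>i. w (i div n) (i mod n))"
    have u: "u (p * n + r) = w p r" if "r < n" for p r using that by (simp add: u_def)
    have "left_chain n m E A B (\<lambda>p r. u (p * n + r))"
      using w by (simp add: left_chain_def u del: mult_Suc)
    moreover have "j * n + r < n\<^sup>2"
    proof -
      have "j * n + r < Suc j * n" using jr by simp
      also have "\<dots> \<le> n * n" using jr by (intro mult_right_mono) auto
      finally show ?thesis by (simp add: power2_eq_square)
    qed
    ultimately show "\<exists>u. left_chain n m E A B (\<lambda>p r. u (p * n + r)) \<and> (\<exists>i<n\<^sup>2. u i \<noteq> 0)"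
      using jr u by metis
  qed
  finally show ?thesis .
qed

text \<open>Each side fails exactly when a nonzero chain exists.\<close>

lemma full_row_rank_ctrb_mat_iff_C_controllable:
  assumes "E \<in> carrier_mat n n" "A \<in> carrier_mat n n" "B \<in> carrier_mat n m"
  shows "full_row_rank (ctrb_mat n m E A B) \<longleftrightarrow> C_controllable n E A B"
  using ctrb_mat_rank_deficient_iff[OF assms] uncontrollable_imp_left_chain[OF assms]
    left_chain_imp_uncontrollable[OF assms] by blast

section \<open>Closedness, compactness and attainment of the minimum\<close>

lemma perturbation_set_affine:
  assumes "perturbation_set nr nc S"
  shows "affine_mats nr nc S"
proof -
  have "affine_mats nr nc S" if "VectorSpace.subspace class_ring S (module_mat TYPE(real) nr nc)"
  proof -
    from that have "submodule class_ring S (module_mat TYPE(real) nr nc)" by (simp add: VectorSpace.subspace_def)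
    from submodule.subset[OF this] submodule.m_closed[OF this] submodule.smult_closed[OF this]
    show ?thesis by (auto simp: affine_mats_def module_mat_simps class_ring_simps)
  qed
  then show ?thesis using assms by (auto simp: perturbation_set_def)
qed

text \<open>The differences from the point \<open>X 0\<close> form a linear subspace. If the limit
  \<open>L\<close> were outside \<open>S\<close>, a linear functional would vanish on this subspace
  but not at \<open>L - X 0\<close>, although \<open>L - X 0\<close> is the limit of the differences
  \<open>X k - X 0\<close>.\<close>

lemma affine_mats_closed:
  assumes aff: "affine_mats nr nc S" and X: "\<And>k. X k \<in> S"
    and lim: "\<And>i j. i < nr \<Longrightarrow> j < nc \<Longrightarrow> (\<lambda>k. X k $$ (i, j)) \<longlonglongrightarrow> L $$ (i, j)"
    and L: "L \<in> carrier_mat nr nc"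
  shows "L \<in> S"
proof (rule ccontr)
  assume nL: "L \<notin> S"
  have carr: "Y \<in> carrier_mat nr nc" if "Y \<in> S" for Y using aff that by (auto simp: affine_mats_def)
  have comb: "u \<cdot>\<^sub>m Y + v \<cdot>\<^sub>m Z \<in> S" if "Y \<in> S" "Z \<in> S" "u + v = 1" for Y Z u v
    using aff that by (auto simp: affine_mats_def)
  let ?I = "{..<nr} \<times> {..<nc}"
  define P where "P = (\<lambda>f. mat nr nc (\<lambda>ij. X 0 $$ ij + f ij))"
  have P_scale: "P (\<lambda>ij. t * f ij) \<in> S" if "P f \<in> S" for f t
  proof -
    have "P (\<lambda>ij. t * f ij) = t \<cdot>\<^sub>m P f + (1 - t) \<cdot>\<^sub>m X 0"
      using carr[OF X[of 0]] by (intro eq_matI) (auto simp: P_def algebra_simps)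
    then show ?thesis using comb[OF that X[of 0], of t "1 - t"] by simp
  qed
  have P_add: "P (\<lambda>ij. f ij + g ij) \<in> S" if "P f \<in> S" "P g \<in> S" for f g
  proof -
    \<comment> \<open>The weights must sum to 1, so a sum of directions is reached as the midpoint
      of the doubled ones.\<close>
    have "P (\<lambda>ij. f ij + g ij) = (1 / 2) \<cdot>\<^sub>m P (\<lambda>ij. 2 * f ij) + (1 / 2) \<cdot>\<^sub>m P (\<lambda>ij. 2 * g ij)"
      by (intro eq_matI) (auto simp: P_def algebra_simps)
    then show ?thesis using comb[OF P_scale P_scale, of f g "1 / 2" "1 / 2" 2 2] that by simp
  qed
  have P_diff: "P (\<lambda>ij. Y $$ ij - X 0 $$ ij) = Y" if "Y \<in> carrier_mat nr nc" for Y
    using that by (intro eq_matI) (auto simp: P_def)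
  have "\<exists>w. (\<forall>f\<in>{f. P f \<in> S}. (\<Sum>ij\<in>?I. w ij * f ij) = 0) \<and>
      (\<Sum>ij\<in>?I. w ij * (L $$ ij - X 0 $$ ij)) \<noteq> 0"
  proof (rule separating_functional)
    have "P (\<lambda>_. 0) = X 0" using carr[OF X[of 0]] by (intro eq_matI) (auto simp: P_def)
    then show "(\<lambda>_. 0) \<in> {f. P f \<in> S}" using X[of 0] by simp
  next
    fix f assume f: "f \<in> {f. P f \<in> S}"
    show "\<exists>ij\<in>?I. f ij \<noteq> L $$ ij - X 0 $$ ij"
    proof (rule ccontr)
      assume "\<not> ?thesis"
      then have "P f = L" using L by (intro eq_matI) (auto simp: P_def)
      then show False using f nL by simp
    qed
  qed (use P_add P_scale in auto)
  then obtain w where w: "\<And>f. P f \<in> S \<Longrightarrow> (\<Sum>ij\<in>?I. w ij * f ij) = 0"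
    and wL: "(\<Sum>ij\<in>?I. w ij * (L $$ ij - X 0 $$ ij)) \<noteq> 0" by auto
  have "(\<lambda>k. \<Sum>ij\<in>?I. w ij * (X k $$ ij - X 0 $$ ij)) \<longlonglongrightarrow> (\<Sum>ij\<in>?I. w ij * (L $$ ij - X 0 $$ ij))"
    using lim by (intro tendsto_intros) auto
  moreover have "(\<Sum>ij\<in>?I. w ij * (X k $$ ij - X 0 $$ ij)) = 0" for k
    using X P_diff[OF carr[OF X[of k]]] by (intro w) simp
  ultimately show False using wL by (simp add: LIMSEQ_const_iff)
qed

text \<open>Indices are added one at a time: a bounded sequence has a monotone, hence convergent,
  subsequence, and thinning out further keeps the convergence already obtained.\<close>

lemma bounded_family_convergent_subseq:
  fixes f :: "nat \<Rightarrow> 'i \<Rightarrow> real"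
  assumes "finite I" and "\<And>k i. i \<in> I \<Longrightarrow> \<bar>f k i\<bar> \<le> b"
  shows "\<exists>\<phi>. strict_mono (\<phi> :: nat \<Rightarrow> nat) \<and> (\<forall>i\<in>I. convergent (\<lambda>k. f (\<phi> k) i))"
  using assms
proof (induction I rule: finite_induct)
  case empty
  then show ?case by (intro exI[of _ id]) (auto simp: strict_mono_def)
next
  case (insert a I)
  then obtain \<phi> where \<phi>: "strict_mono \<phi>" "\<And>i. i \<in> I \<Longrightarrow> convergent (\<lambda>k. f (\<phi> k) i)" by auto
  have "Bseq (\<lambda>k. f (\<phi> k) a)" using insert.prems by (intro BseqI'[of _ b]) auto
  obtain \<psi> where \<psi>: "strict_mono \<psi>" "monoseq (\<lambda>k. f (\<phi> (\<psi> k)) a)"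
    using seq_monosub[of "\<lambda>k. f (\<phi> k) a"] by auto
  have "convergent (\<lambda>k. f (\<phi> (\<psi> k)) a)"
    using Bseq_monoseq_convergent[OF Bseq_subseq[OF \<open>Bseq _\<close>, of \<psi>] \<psi>(2)] .
  moreover
  have "convergent (\<lambda>k. f (\<phi> (\<psi> k)) i)" if "i \<in> I" for i
    using convergent_subseq_convergent[OF \<phi>(2)[OF that] \<psi>(1)] by (simp add: o_def)
  ultimately show ?case
    using \<phi>(1) \<psi>(1) by (intro exI[of _ "\<phi> \<circ> \<psi>"] conjI strict_mono_o) auto
qed

lemma abs_entry_le_frob_norm:
  assumes "i < dim_row M" "j < dim_col M"
  shows "\<bar>M $$ (i, j)\<bar> \<le> frob_norm M"
proof -
  have "(M $$ (i, j))\<^sup>2 \<le> (\<Sum>j<dim_col M. (M $$ (i, j))\<^sup>2)"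
    using assms(2) by (intro member_le_sum) auto
  also have "\<dots> \<le> (\<Sum>i<dim_row M. \<Sum>j<dim_col M. (M $$ (i, j))\<^sup>2)"
    using assms(1) by (intro member_le_sum[where f = "\<lambda>i. \<Sum>j<dim_col M. (M $$ (i, j))\<^sup>2"]) (auto intro: sum_nonneg)
  finally show ?thesis unfolding frob_norm_def by (intro real_le_rsqrt) simp
qed

lemma left_chain_scale: "left_chain n m E A B w \<Longrightarrow> left_chain n m E A B (\<lambda>j r. t * w j r)"
  unfolding left_chain_def by (simp add: mult.assoc flip: sum_distrib_left)

text \<open>A limit of nonzero chains may be zero, whereas the equation that the squares sum to 1
  survives limits and bounds all entries.\<close>

lemma left_chain_normalize:
  assumes "left_chain n m E A B w" and "\<exists>j<n. \<exists>r<n. w j r \<noteq> 0"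
  shows "\<exists>w'. left_chain n m E A B w' \<and> (\<Sum>(j, r)\<in>{..<n} \<times> {..<n}. (w' j r)\<^sup>2) = 1"
proof -
  let ?s = "\<Sum>(j, r)\<in>{..<n} \<times> {..<n}. (w j r)\<^sup>2"
  obtain j r where jr: "j < n" "r < n" "w j r \<noteq> 0" using assms(2) by blast
  have "0 < (w j r)\<^sup>2" using jr(3) by simp
  also have "\<dots> \<le> ?s"
    using jr member_le_sum[of "(j, r)" "{..<n} \<times> {..<n}" "\<lambda>(j, r). (w j r)\<^sup>2"] by auto
  finally have s: "?s > 0" .
  define t where "t = inverse (sqrt ?s)"
  have "(\<Sum>(j, r)\<in>{..<n} \<times> {..<n}. (t * w j r)\<^sup>2) = t\<^sup>2 * ?s"
    by (simp add: sum_distrib_left power_mult_distrib case_prod_unfold)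
  also have "\<dots> = 1" using s by (simp add: t_def power_inverse)
  finally show ?thesis using left_chain_scale[OF assms(1), of t] by blast
qed

lemma left_chain_limit:
  assumes "\<And>k. left_chain n m (E k) (A k) (B k) (w k)"
    and "\<And>i j. i < n \<Longrightarrow> j < n \<Longrightarrow> (\<lambda>k. E k $$ (i, j)) \<longlonglongrightarrow> E' $$ (i, j)"
    and "\<And>i j. i < n \<Longrightarrow> j < n \<Longrightarrow> (\<lambda>k. A k $$ (i, j)) \<longlonglongrightarrow> A' $$ (i, j)"
    and "\<And>i j. i < n \<Longrightarrow> j < m \<Longrightarrow> (\<lambda>k. B k $$ (i, j)) \<longlonglongrightarrow> B' $$ (i, j)"
    and "\<And>i j. i < n \<Longrightarrow> j < n \<Longrightarrow> (\<lambda>k. w k i j) \<longlonglongrightarrow> w' i j"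
  shows "left_chain n m E' A' B' w'"
  unfolding left_chain_def
proof (intro conjI allI impI)
  fix j c assume jc: "j < n - 1" "c < n"
  have "(\<lambda>k. \<Sum>r<n. w k j r * A k $$ (r, c)) \<longlonglongrightarrow> (\<Sum>r<n. w' j r * A' $$ (r, c))"
    using jc by (intro tendsto_intros assms) auto
  moreover have "(\<lambda>k. \<Sum>r<n. w k j r * A k $$ (r, c)) = (\<lambda>k. \<Sum>r<n. w k (Suc j) r * E k $$ (r, c))"
    using assms(1) jc by (simp add: left_chain_def)
  moreover have "(\<lambda>k. \<Sum>r<n. w k (Suc j) r * E k $$ (r, c)) \<longlonglongrightarrow> (\<Sum>r<n. w' (Suc j) r * E' $$ (r, c))"
    using jc by (intro tendsto_intros assms) auto
  ultimately show "(\<Sum>r<n. w' j r * A' $$ (r, c)) = (\<Sum>r<n. w' (Suc j) r * E' $$ (r, c))"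
    by (simp only:) (rule LIMSEQ_unique)
next
  fix j c assume jc: "j < n" "c < m"
  have "(\<lambda>k. \<Sum>r<n. w k j r * B k $$ (r, c)) \<longlonglongrightarrow> (\<Sum>r<n. w' j r * B' $$ (r, c))"
    using jc by (intro tendsto_intros assms) auto
  moreover have "(\<Sum>r<n. w k j r * B k $$ (r, c)) = 0" for k
    using assms(1) jc by (simp add: left_chain_def)
  ultimately show "(\<Sum>r<n. w' j r * B' $$ (r, c)) = 0" by (simp add: LIMSEQ_const_iff)
qed

text \<open>A minimizing sequence of perturbations is accompanied by normalized chains that certify
  the rank deficiency. The norms bound the perturbations and the normalization bounds the chains, so
  a subsequence of everything converges. The limit is admissible by closedness, is certified by the
  limit chain, and attains the infimum by continuity of the norm.\<close>

lemma rank_deficient_norms_has_minimum: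
  assumes E: "E \<in> carrier_mat n n" and A: "A \<in> carrier_mat n n" and B: "B \<in> carrier_mat n m"
    and SE: "affine_mats n n SE" and SA: "affine_mats n n SA" and SB: "affine_mats n m SB"
    and ne: "rank_deficient_norms n m E A B SE SA SB \<noteq> {}"
  shows "\<exists>x. is_minimum (rank_deficient_norms n m E A B SE SA SB) x"
proof -
  let ?N = "rank_deficient_norms n m E A B SE SA SB"
  have carr: "SE \<subseteq> carrier_mat n n" "SA \<subseteq> carrier_mat n n" "SB \<subseteq> carrier_mat n m"
    using SE SA SB by (auto simp: affine_mats_def)
  let ?S = "{..<n} \<times> {..<n}"
  have deficient_iff: "\<not> full_row_rank (ctrb_mat n m (E + X) (A + Y) (B + Z)) \<longleftrightarrow>
      (\<exists>w. left_chain n m (E + X) (A + Y) (B + Z) w \<and> (\<Sum>(j, r)\<in>?S. (w j r)\<^sup>2) = 1)"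
    if "X \<in> SE" "Y \<in> SA" "Z \<in> SB" for X Y Z
  proof -
    have "\<exists>j<n. \<exists>r<n. w j r \<noteq> 0" if "(\<Sum>(j, r)\<in>?S. (w j r)\<^sup>2) = 1" for w :: "nat \<Rightarrow> nat \<Rightarrow> real"
    proof (rule ccontr)
      assume "\<not> ?thesis"
      then have "(\<Sum>(j, r)\<in>?S. (w j r)\<^sup>2) = 0" by (intro sum.neutral) auto
      then show False using that by simp
    qed
    note nonzero = this
    have "\<not> full_row_rank (ctrb_mat n m (E + X) (A + Y) (B + Z)) \<longleftrightarrow>
        (\<exists>w. left_chain n m (E + X) (A + Y) (B + Z) w \<and> (\<exists>j<n. \<exists>r<n. w j r \<noteq> 0))"
      using that carr by (intro ctrb_mat_rank_deficient_iff) auto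
    also have "\<dots> \<longleftrightarrow> (\<exists>w. left_chain n m (E + X) (A + Y) (B + Z) w \<and> (\<Sum>(j, r)\<in>?S. (w j r)\<^sup>2) = 1)"
      (is "?L = ?R")
    proof
      assume ?L
      then obtain w where "left_chain n m (E + X) (A + Y) (B + Z) w" "\<exists>j<n. \<exists>r<n. w j r \<noteq> 0"
        by blast
      then show ?R by (rule left_chain_normalize)
    next
      assume ?R
      then obtain w where "left_chain n m (E + X) (A + Y) (B + Z) w" "(\<Sum>(j, r)\<in>?S. (w j r)\<^sup>2) = 1"
        by (elim exE conjE)
      with nonzero[OF this(2)] show ?L by (intro exI[of _ w] conjI)
    qed
    finally show ?thesis .
  qed
  have bdd: "bdd_below ?N"
    by (rule bdd_belowI[of _ 0]) (auto simp: rank_deficient_norms_def frob_norm_def intro!: sum_nonneg)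
  have "\<exists>X Y Z w. X \<in> SE \<and> Y \<in> SA \<and> Z \<in> SB \<and> left_chain n m (E + X) (A + Y) (B + Z) w \<and>
      (\<Sum>(j, r)\<in>?S. (w j r)\<^sup>2) = 1 \<and> frob_norm (X @\<^sub>c Y @\<^sub>c Z) < Inf ?N + inverse (real (Suc k))" for k
  proof -
    obtain x where x: "x \<in> ?N" "x < Inf ?N + inverse (real (Suc k))"
      using cInf_lessD[OF ne, of "Inf ?N + inverse (real (Suc k))"] by auto
    then obtain X Y Z where XYZ: "X \<in> SE" "Y \<in> SA" "Z \<in> SB" "x = frob_norm (X @\<^sub>c Y @\<^sub>c Z)"
      "\<not> full_row_rank (ctrb_mat n m (E + X) (A + Y) (B + Z))"
      unfolding rank_deficient_norms_def by blast
    then show ?thesis using x(2) deficient_iff[OF XYZ(1-3)] by blast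
  qed
  then obtain X Y Z w where X: "\<And>k. X k \<in> SE" and Y: "\<And>k. Y k \<in> SA" and Z: "\<And>k. Z k \<in> SB"
    and w: "\<And>k. left_chain n m (E + X k) (A + Y k) (B + Z k) (w k)"
    and w1: "\<And>k. (\<Sum>(j, r)\<in>?S. (w k j r)\<^sup>2) = 1"
    and lt: "\<And>k. frob_norm (X k @\<^sub>c Y k @\<^sub>c Z k) < Inf ?N + inverse (real (Suc k))"
    by metis
  define D where "D = (\<lambda>k. X k @\<^sub>c Y k @\<^sub>c Z k)"
  have Xc: "X k \<in> carrier_mat n n" and Yc: "Y k \<in> carrier_mat n n" and Zc: "Z k \<in> carrier_mat n m" for k
    using X Y Z carr by auto
  have Dc: "D k \<in> carrier_mat n (n + (n + m))" for k
    unfolding D_def by (intro append_cols_carrier Xc Yc Zc)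
  have DX: "D k $$ (i, j) = X k $$ (i, j)" if "i < n" "j < n" for k i j
    using that by (simp add: D_def append_cols_index[OF Xc append_cols_carrier[OF Yc Zc]])
  have DY: "D k $$ (i, n + j) = Y k $$ (i, j)" if "i < n" "j < n" for k i j
    using that by (simp add: D_def append_cols_index[OF Xc append_cols_carrier[OF Yc Zc]]
        append_cols_index[OF Yc Zc])
  have DZ: "D k $$ (i, n + (n + j)) = Z k $$ (i, j)" if "i < n" "j < m" for k i j
    using that by (simp add: D_def append_cols_index[OF Xc append_cols_carrier[OF Yc Zc]]
        append_cols_index[OF Yc Zc])
  \<comment> \<open>Perturbation entries and chain entries form one family over a disjoint sum, so
    that a single subsequence serves both.\<close>
  define f where "f = (\<lambda>k. case_sum (\<lambda>ij. D k $$ ij) (\<lambda>(j, r). w k j r))"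
  have D_bound: "\<bar>D k $$ (i, j)\<bar> \<le> Inf ?N + 1" if "i < n" "j < n + (n + m)" for k i j
  proof -
    have "\<bar>D k $$ (i, j)\<bar> \<le> frob_norm (D k)"
      using Dc[of k] that by (intro abs_entry_le_frob_norm) auto
    also have "\<dots> < Inf ?N + inverse (real (Suc k))" unfolding D_def by (rule lt)
    also have "\<dots> \<le> Inf ?N + 1" by (simp add: field_simps)
    finally show ?thesis by simp
  qed
  have w_bound: "\<bar>w k j r\<bar> \<le> 1" if "j < n" "r < n" for k j r
  proof -
    have "(w k j r)\<^sup>2 \<le> 1"
      using that member_le_sum[of "(j, r)" ?S "\<lambda>(j, r). (w k j r)\<^sup>2"] w1[of k] by auto
    then show ?thesis by (simp add: abs_square_le_1)
  qed
  have "\<bar>f k i\<bar> \<le> max (Inf ?N + 1) 1" if "i \<in> ({..<n} \<times> {..<n + (n + m)}) <+> ?S" for k i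
    using that by (auto simp: f_def intro!: max.coboundedI1[OF D_bound] max.coboundedI2[OF w_bound])
  then obtain \<phi> where \<phi>: "strict_mono \<phi>"
    "\<And>i. i \<in> ({..<n} \<times> {..<n + (n + m)}) <+> ?S \<Longrightarrow> convergent (\<lambda>k. f (\<phi> k) i)"
    using bounded_family_convergent_subseq[of "({..<n} \<times> {..<n + (n + m)}) <+> ?S" f] by (metis finite_Plus finite_SigmaI finite_lessThan)
  define l where "l = (\<lambda>i. lim (\<lambda>k. f (\<phi> k) i))"
  have lD: "(\<lambda>k. D (\<phi> k) $$ (i, j)) \<longlonglongrightarrow> l (Inl (i, j))" if "i < n" "j < n + (n + m)" for i j
    using \<phi>(2)[of "Inl (i, j)"] that by (auto simp: l_def f_def convergent_LIMSEQ_iff)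
  have lw: "(\<lambda>k. w (\<phi> k) j r) \<longlonglongrightarrow> l (Inr (j, r))" if "j < n" "r < n" for j r
    using \<phi>(2)[of "Inr (j, r)"] that by (auto simp: l_def f_def convergent_LIMSEQ_iff)
  define X' where "X' = mat n n (\<lambda>(i, j). l (Inl (i, j)))"
  define Y' where "Y' = mat n n (\<lambda>(i, j). l (Inl (i, n + j)))"
  define Z' where "Z' = mat n m (\<lambda>(i, j). l (Inl (i, n + (n + j))))"
  define w' where "w' = (\<lambda>j r. l (Inr (j, r)))"
  have c': "X' \<in> carrier_mat n n" "Y' \<in> carrier_mat n n" "Z' \<in> carrier_mat n m"
    by (auto simp: X'_def Y'_def Z'_def)
  have limX: "(\<lambda>k. X (\<phi> k) $$ (i, j)) \<longlonglongrightarrow> X' $$ (i, j)" if "i < n" "j < n" for i j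
    using lD[of i j] that by (simp add: DX X'_def)
  have limY: "(\<lambda>k. Y (\<phi> k) $$ (i, j)) \<longlonglongrightarrow> Y' $$ (i, j)" if "i < n" "j < n" for i j
    using lD[of i "n + j"] that by (simp add: DY Y'_def)
  have limZ: "(\<lambda>k. Z (\<phi> k) $$ (i, j)) \<longlonglongrightarrow> Z' $$ (i, j)" if "i < n" "j < m" for i j
    using lD[of i "n + (n + j)"] that by (simp add: DZ Z'_def)
  have mem: "X' \<in> SE" "Y' \<in> SA" "Z' \<in> SB"
    using affine_mats_closed[OF SE, of "\<lambda>k. X (\<phi> k)"] affine_mats_closed[OF SA, of "\<lambda>k. Y (\<phi> k)"]
      affine_mats_closed[OF SB, of "\<lambda>k. Z (\<phi> k)"] X Y Z limX limY limZ c' by blast+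
  have "left_chain n m (E + X') (A + Y') (B + Z') w'"
  proof (rule left_chain_limit)
    show "left_chain n m (E + X (\<phi> k)) (A + Y (\<phi> k)) (B + Z (\<phi> k)) (w (\<phi> k))" for k by (rule w)
    show "(\<lambda>k. (E + X (\<phi> k)) $$ (i, j)) \<longlonglongrightarrow> (E + X') $$ (i, j)" if "i < n" "j < n" for i j
      using that Xc c' by (simp add: carrier_matD[OF Xc] carrier_matD[OF c'(1)] limX tendsto_add)
    show "(\<lambda>k. (A + Y (\<phi> k)) $$ (i, j)) \<longlonglongrightarrow> (A + Y') $$ (i, j)" if "i < n" "j < n" for i j
      using that by (simp add: carrier_matD[OF Yc] carrier_matD[OF c'(2)] limY tendsto_add)
    show "(\<lambda>k. (B + Z (\<phi> k)) $$ (i, j)) \<longlonglongrightarrow> (B + Z') $$ (i, j)" if "i < n" "j < m" for i j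
      using that by (simp add: carrier_matD[OF Zc] carrier_matD[OF c'(3)] limZ tendsto_add)
    show "(\<lambda>k. w (\<phi> k) i j) \<longlonglongrightarrow> w' i j" if "i < n" "j < n" for i j
      using lw that by (simp add: w'_def)
  qed
  moreover have "(\<Sum>(j, r)\<in>?S. (w' j r)\<^sup>2) = 1"
  proof -
    have "(\<lambda>k. \<Sum>jr\<in>?S. (w (\<phi> k) (fst jr) (snd jr))\<^sup>2) \<longlonglongrightarrow> (\<Sum>jr\<in>?S. (w' (fst jr) (snd jr))\<^sup>2)"
      using lw by (intro tendsto_intros) (auto simp: w'_def)
    then show ?thesis using w1[unfolded case_prod_unfold] by (simp add: case_prod_unfold LIMSEQ_const_iff)
  qed
  ultimately have "\<not> full_row_rank (ctrb_mat n m (E + X') (A + Y') (B + Z'))"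
    using deficient_iff[OF mem] by blast
  then have inN: "frob_norm (X' @\<^sub>c Y' @\<^sub>c Z') \<in> ?N"
    unfolding rank_deficient_norms_def using mem by blast
  have Dc': "X' @\<^sub>c Y' @\<^sub>c Z' \<in> carrier_mat n (n + (n + m))"
    by (intro append_cols_carrier c')
  have "(\<lambda>k. D (\<phi> k) $$ (i, j)) \<longlonglongrightarrow> (X' @\<^sub>c Y' @\<^sub>c Z') $$ (i, j)" if "i < n" "j < n + (n + m)" for i j
  proof -
    have "(X' @\<^sub>c Y' @\<^sub>c Z') $$ (i, j) = l (Inl (i, j))"
      using that by (auto simp: append_cols_index[OF c'(1) append_cols_carrier[OF c'(2,3)]]
        append_cols_index[OF c'(2,3)]) (auto simp: X'_def Y'_def Z'_def)
    then show ?thesis using lD[OF that] by simp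
  qed
  then have "(\<lambda>k. frob_norm (D (\<phi> k))) \<longlonglongrightarrow> frob_norm (X' @\<^sub>c Y' @\<^sub>c Z')"
    unfolding frob_norm_def carrier_matD[OF Dc] carrier_matD[OF Dc']
    by (intro tendsto_intros) auto
  moreover have "(\<lambda>k. Inf ?N + inverse (real (Suc k))) \<longlonglongrightarrow> Inf ?N + 0"
    by (intro tendsto_intros LIMSEQ_inverse_real_of_nat)
  \<comment> \<open>A strictly increasing \<open>\<phi>\<close> satisfies
    \<open>k \<le> \<phi> k\<close>, so the bound at \<open>\<phi> k\<close> is at most the one at
    \<open>k\<close>.\<close>
  moreover have "frob_norm (D (\<phi> k)) \<le> Inf ?N + inverse (real (Suc k))" for k
  proof -
    have "frob_norm (D (\<phi> k)) \<le> Inf ?N + inverse (real (Suc (\<phi> k)))"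
      unfolding D_def using lt[of "\<phi> k"] by simp
    also have "\<dots> \<le> Inf ?N + inverse (real (Suc k))"
      using strict_mono_imp_increasing[OF \<phi>(1), of k] by (simp add: field_simps)
    finally show ?thesis .
  qed
  ultimately have "frob_norm (X' @\<^sub>c Y' @\<^sub>c Z') \<le> Inf ?N"
    using LIMSEQ_le by fastforce
  then show ?thesis
    using inN cInf_lower[OF _ bdd] unfolding is_minimum_def by (meson order_trans)
qed

section \<open>Equality of the two minima\<close>

theorem mainTheorem3:
  fixes n m :: nat
    and E A B :: "real mat"
    and SE SA SB :: "real mat set"
  assumes "E \<in> carrier_mat n n" and "A \<in> carrier_mat n n" and "B \<in> carrier_mat n m"
    and "perturbation_set n n SE" and "perturbation_set n n SA" and "perturbation_set n m SB"
  shows "(uncontrollable_norms n E A B SE SA SB = {} \<longleftrightarrow>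
            rank_deficient_norms n m E A B SE SA SB = {}) \<and>
         (uncontrollable_norms n E A B SE SA SB \<noteq> {} \<longrightarrow>
            is_minimum (uncontrollable_norms n E A B SE SA SB)
              (structured_radius n E A B SE SA SB) \<and>
            is_minimum (rank_deficient_norms n m E A B SE SA SB)
              (structured_radius n E A B SE SA SB) \<and>
            (\<exists>DE DA DB. nearest_SLRA n m E A B SE SA SB DE DA DB)) \<and>
         (\<forall>DE DA DB. nearest_SLRA n m E A B SE SA SB DE DA DB \<longrightarrow>
            structured_radius n E A B SE SA SB = frob_norm (DE @\<^sub>c DA @\<^sub>c DB))"
proof -
  let ?U = "uncontrollable_norms n E A B SE SA SB"
  let ?R = "rank_deficient_norms n m E A B SE SA SB"
  note aff = assms(4-6)[THEN perturbation_set_affine]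
  have "E + DE \<in> carrier_mat n n" "A + DA \<in> carrier_mat n n" "B + DB \<in> carrier_mat n m"
    if "DE \<in> SE" "DA \<in> SA" "DB \<in> SB" for DE DA DB
    using that aff by (auto simp: affine_mats_def)
  \<comment> \<open>The feasible perturbations of the two problems coincide, so the sets of norms
    are equal, not only their minima.\<close>
  then have UR: "?U = ?R"
    unfolding uncontrollable_norms_def rank_deficient_norms_def
    by (metis (no_types, opaque_lifting) full_row_rank_ctrb_mat_iff_C_controllable)
  \<comment> \<open>\<open>LEAST\<close> on the reals has a known value only once a minimum is known
    to exist, which is why attainment had to be proved.\<close>
  have radius: "structured_radius n E A B SE SA SB = x" if "is_minimum ?R x" for x
    using that unfolding structured_radius_def UR is_minimum_def by (intro Least_equality) auto
  have nearest_iff: "nearest_SLRA n m E A B SE SA SB DE DA DB \<longleftrightarrow>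
      DE \<in> SE \<and> DA \<in> SA \<and> DB \<in> SB \<and> \<not> full_row_rank (ctrb_mat n m (E + DE) (A + DA) (B + DB)) \<and>
      (\<forall>x\<in>?R. frob_norm (DE @\<^sub>c DA @\<^sub>c DB) \<le> x)" for DE DA DB
    unfolding nearest_SLRA_def is_arg_min_linorder rank_deficient_norms_def by auto
  have nearest_min: "is_minimum ?R (frob_norm (DE @\<^sub>c DA @\<^sub>c DB))"
    if "nearest_SLRA n m E A B SE SA SB DE DA DB" for DE DA DB
    using that unfolding nearest_iff is_minimum_def rank_deficient_norms_def by blast
  have "is_minimum ?R (structured_radius n E A B SE SA SB) \<and>
      (\<exists>DE DA DB. nearest_SLRA n m E A B SE SA SB DE DA DB)" if R: "?R \<noteq> {}"
  proof -
    obtain x where x: "is_minimum ?R x"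
      using rank_deficient_norms_has_minimum[OF assms(1-3) aff R] by blast
    then obtain DE DA DB where "x = frob_norm (DE @\<^sub>c DA @\<^sub>c DB)" "DE \<in> SE" "DA \<in> SA" "DB \<in> SB"
      "\<not> full_row_rank (ctrb_mat n m (E + DE) (A + DA) (B + DB))"
      unfolding is_minimum_def rank_deficient_norms_def by blast
    then have "nearest_SLRA n m E A B SE SA SB DE DA DB"
      using x unfolding nearest_iff is_minimum_def by blast
    then show ?thesis using x radius by blast
  qed
  then show ?thesis using UR radius nearest_min by auto
qed

end
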